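(* Let $G$ be a finite non-cyclic group. If $G$ has an equal covering $\Pi=\{H_i\}$, then $\exp(G)$ divides $|H_i|$ for all $H_i\in\Pi$.
   Context: A covering of a group $G$ is a collection of proper subgroups of $G$ whose set-theoretic union is $G$. An equal covering of $G$ is a covering of $G$ all of whose members have the same order. The exponent $\exp(G)$ is the smallest positive integer $n$ such that $a^n=1$ for all $a\in G$. *)

theory Defs
  imports "HOL-Algebra.Elementary_Groups"
begin

definition group_covering :: "('a, 'b) monoid_scheme \<Rightarrow> 'a set set \<Rightarrow> bool"
  where "group_covering G \<H> \<longleftrightarrow>
    (\<forall>H\<in>\<H>. subgroup H G \<and> H \<noteq> carrier G) \<and> \<Union>\<H> = carrier G"

(* The order of a subgroup is rendered by card, which identifies all infinite orders;
   the notion is meant for finite groups. *)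
definition equal_covering :: "('a, 'b) monoid_scheme \<Rightarrow> 'a set set \<Rightarrow> bool"
  where "equal_covering G \<H> \<longleftrightarrow>
    group_covering G \<H> \<and> (\<forall>H\<in>\<H>. \<forall>K\<in>\<H>. card H = card K)"

(* Unspecified if no positive n works; for finite groups one always does. *)
definition group_exponent :: "('a, 'b) monoid_scheme \<Rightarrow> nat"
  where "group_exponent G =
    (LEAST n::nat. n > 0 \<and> (\<forall>a\<in>carrier G. a [^]\<^bsub>G\<^esub> n = \<one>\<^bsub>G\<^esub>))"

end

theory Submission
  imports Defs "HOL-Algebra.Multiplicative_Group"
begin

text \<open>Fix a member H of the covering. Each a in G lies in some member K, so Lagrange's theorem
  inside K (\<open>subgroup_pow_card_eq_one\<close>) gives a^|K| = 1, and |K| = |H|. Hence the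
  single number |H| annihilates all of G, and the exponent divides every positive number that does
  so (\<open>group_exponent_dvd\<close>).\<close>

lemma (in group) subgroup_pow_card_eq_one:
  assumes "subgroup H G" and "a \<in> H"
  shows "a [^] card H = \<one>"
proof -
  interpret H: group "G\<lparr>carrier := H\<rparr>"
    using assms(1) by (rule subgroup_imp_group)
  have "a [^]\<^bsub>G\<lparr>carrier := H\<rparr>\<^esub> card H = \<one>"
    using H.pow_order_eq_1[of a] assms(2) by (simp add: order_def)
  then show ?thesis
    by (simp flip: nat_pow_consistent)
qed

text \<open>Division with remainder: a nonzero remainder of \<open>n\<close> modulo the exponent
  would be a smaller positive number annihilating the group, against minimality.\<close>

lemma (in group) group_exponent_dvd:
  assumes "n > 0" and "\<And>a. a \<in> carrier G \<Longrightarrow> a [^] n = \<one>"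
  shows "group_exponent G dvd n"
proof (rule ccontr)
  let ?P = "\<lambda>n::nat. n > 0 \<and> (\<forall>a\<in>carrier G. a [^] n = \<one>)"
  define e where "e = group_exponent G"
  have "?P n"
    using assms by blast
  \<comment> \<open>The given \<open>n\<close> witnesses that some positive number annihilates the
    group, so the \<open>LEAST\<close> is well specified.\<close>
  then have "?P e"
    unfolding e_def group_exponent_def by (rule LeastI)
  assume "\<not> group_exponent G dvd n"
  then have "n mod e > 0"
    by (simp add: e_def dvd_eq_mod_eq_0)
  moreover have "a [^] (n mod e) = \<one>" if a: "a \<in> carrier G" for a
  proof -
    have "\<one> = a [^] (e * (n div e) + n mod e)"
      using assms(2) a by simp
    also have "\<dots> = (a [^] e) [^] (n div e) \<otimes> a [^] (n mod e)"
      using a by (simp only: nat_pow_mult nat_pow_pow nat_pow_closed)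
    also have "\<dots> = a [^] (n mod e)"
      using a \<open>?P e\<close> by simp
    finally show ?thesis by simp
  qed
  ultimately have "?P (n mod e)"
    by blast
  then have "e \<le> n mod e"
    unfolding e_def group_exponent_def by (rule Least_le)
  with \<open>?P e\<close> show False
    by (meson mod_less_divisor not_le)
qed

theorem theorem13:
  fixes G :: "('a, 'b) monoid_scheme" and \<H> :: "'a set set"
  assumes "group G"
    and "finite (carrier G)"
    and "\<not> cyclic_group G"
    and "equal_covering G \<H>"
  shows "\<forall>H\<in>\<H>. group_exponent G dvd card H"
proof
  interpret group G by fact
  fix H assume H: "H \<in> \<H>"
  have sub: "subgroup K G" if "K \<in> \<H>" for K
    using assms(4) that unfolding equal_covering_def group_covering_def by blast
  show "group_exponent G dvd card H"
  proof (rule group_exponent_dvd)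
    \<comment> \<open>Finiteness of G enters here: it rules out the default value 0 that
      \<open>card\<close> takes on infinite sets.\<close>
    show "card H > 0"
      using sub[OF H] assms(2) by (rule subgroup.finite_imp_card_positive)
  next
    fix a assume "a \<in> carrier G"
    then obtain K where K: "K \<in> \<H>" "a \<in> K"
      using assms(4) unfolding equal_covering_def group_covering_def by blast
    \<comment> \<open>The member K depends on a, but its order does not; this makes one exponent
      serve for all a.\<close>
    then have "card K = card H"
      using assms(4) H unfolding equal_covering_def by blast
    with subgroup_pow_card_eq_one[OF sub[OF K(1)] K(2)] show "a [^]\<^bsub>G\<^esub> card H = \<one>\<^bsub>G\<^esub>"
      by simp
  qed
qed

end
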